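(* Let $\mathcal{H}$ be a real Hilbert space, let $m\in\mathbb{N}\smallsetminus\{0\}$, let $T_1,\ldots,T_m:\mathcal{H}\to\mathcal{H}$ be affine isometries with $\bigcap_{i=1}^m\operatorname{Fix}T_i\ne\varnothing$, and set $\mathcal{S}:=\{T_1,\ldots,T_m\}$. Let $z\in\mathcal{H}$, set $F_ix:=T_i(x+z)-z$ for every $i\in\{1,\ldots,m\}$ and every $x\in\mathcal{H}$, and set $\mathcal{S}_F:=\{F_1,\ldots,F_m\}$. Let $\gamma\in[0,1[$. Then for every $x\in\mathcal{H}$ the following statements are equivalent: (i) For every $k\in\mathbb{N}$, $\|CC_{\mathcal{S}}^kx-\mathrm{P}_{\cap_{i=1}^m\operatorname{Fix}T_i}x\|\le\gamma^k\|x-\mathrm{P}_{\cap_{i=1}^m\operatorname{Fix}T_i}x\|$. (ii) For every $k\in\mathbb{N}$, $\|CC_{\mathcal{S}_F}^k(x-z)-\mathrm{P}_{\cap_{i=1}^m\operatorname{Fix}F_i}(x-z)\|\le\gamma^k\|(x-z)-\mathrm{P}_{\cap_{i=1}^m\operatorname{Fix}F_i}(x-z)\|$. Consequently: (a) Given $x\in\mathcal{H}$, $(CC_{\mathcal{S}}^kx)_{k\in\mathbb{N}}$ converges linearly to $\mathrm{P}_{\cap_{i=1}^m\operatorname{Fix}T_i}x$ with linear rate $\gamma$ if and only if $(CC_{\mathcal{S}_F}^k(x-z))_{k\in\mathbb{N}}$ converges linearly to $\mathrm{P}_{\cap_{i=1}^m\operatorname{Fix}F_i}(x-z)$ with linear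 rate $\gamma$. (b) $(CC_{\mathcal{S}}^kx)_{k\in\mathbb{N}}$ converges linearly to $\mathrm{P}_{\cap_{i=1}^m\operatorname{Fix}T_i}x$ with linear rate $\gamma$ for every $x\in\mathcal{H}$ if and only if $(CC_{\mathcal{S}_F}^ky)_{k\in\mathbb{N}}$ converges linearly to $\mathrm{P}_{\cap_{i=1}^m\operatorname{Fix}F_i}y$ with linear rate $\gamma$ for every $y\in\mathcal{H}$.
   Context: $\mathbb{N}=\{0,1,2,\ldots\}$, and $\gamma^0=1$ also for $\gamma=0$. A map $T:\mathcal{H}\to\mathcal{H}$ is an isometry if $\|Tx-Ty\|=\|x-y\|$ for all $x,y$. $\operatorname{Fix}T=\{x:Tx=x\}$. $\mathrm{P}_C$ is the projector (best approximation operator) onto the nonempty closed convex set $C$. Circumcenter mapping: for a finite set $\mathcal{S}$ of isometries of $\mathcal{H}$ having a common fixed point, and $x\in\mathcal{H}$, let $\mathcal{S}(x)=\{Tx: T\in\mathcal{S}\}$. It is known that there is a unique point $CC_{\mathcal{S}}(x)$ that lies in the affine hull $\operatorname{aff}(\mathcal{S}(x))$ and is equidistant from all points of $\mathcal{S}(x)$; this defines the circumcenter mapping $CC_{\mathcal{S}}:\mathcal{H}\to\mathcal{H}$. $CC_{\mathcal{S}}^k$ is its $k$-fold composition. "$(CC_{\mathcal{S}}^kx)_{k\in\mathbb{N}}$ converges linearly to $p$ with linear rate $\gamma$" means $\|CC_{\mathcal{S}}^kx-p\|\le\gamma^k\|x-p\|$ for all $k\in\mathbb{N}$ (and likewise for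 $\mathcal{S}_F$). *)

theory Defs
  imports "HOL-Analysis.Analysis"
begin

text \<open>Real Hilbert spaces are rendered as types of sort \<open>{real_inner, complete_space}\<close>.\<close>

definition isometry :: "('a::metric_space \<Rightarrow> 'a) \<Rightarrow> bool" where
  "isometry T \<longleftrightarrow> (\<forall>x y. dist (T x) (T y) = dist x y)"

definition affine_map :: "('a::real_vector \<Rightarrow> 'a) \<Rightarrow> bool" where
  "affine_map T \<longleftrightarrow>
    (\<forall>x y u v. u + v = 1 \<longrightarrow> T (u *\<^sub>R x + v *\<^sub>R y) = u *\<^sub>R T x + v *\<^sub>R T y)"

definition Fix :: "('a \<Rightarrow> 'a) \<Rightarrow> 'a set" where
  "Fix T = {x. T x = x}"

text \<open>
  The library's \<open>closest_point\<close> requires sort \<open>heine_borel\<close>, which excludes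
  infinite-dimensional Hilbert spaces. The definite description is meaningful when \<open>C\<close> is
  nonempty, closed and convex.
\<close>

definition projector :: "'a::{real_inner, complete_space} set \<Rightarrow> 'a \<Rightarrow> 'a" where
  "projector C x = (THE p. p \<in> C \<and> (\<forall>y\<in>C. dist x p \<le> dist x y))"

text \<open>
  The definite description is meaningful when \<open>S\<close> is a nonempty finite set of isometries
  with a common fixed point.
\<close>

definition circumcenter_map ::
  "('a::{real_inner, complete_space} \<Rightarrow> 'a) set \<Rightarrow> 'a \<Rightarrow> 'a" where
  "circumcenter_map S x =
    (THE p. p \<in> affine hull {T x |T. T \<in> S} \<and> (\<exists>r. \<forall>y\<in>{T x |T. T \<in> S}. dist p y = r))"

text \<open>
  \<open>u 0\<close> is the starting point of the sequence; for iterates \<open>u k = (f ^^ k) x\<close> it is \<open>x\<close>.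
\<close>

definition converges_linearly ::
  "(nat \<Rightarrow> 'a::real_normed_vector) \<Rightarrow> 'a \<Rightarrow> real \<Rightarrow> bool" where
  "converges_linearly u p \<gamma> \<longleftrightarrow> (\<forall>k. norm (u k - p) \<le> \<gamma> ^ k * norm (u 0 - p))"

end

theory Submission
  imports Defs
begin

text \<open>
  Everything in the statement is carried by the translation \<open>x \<mapsto> x - z\<close>. The map \<open>F i\<close> is
  \<open>T i\<close> conjugated by it, so at \<open>x - z\<close> the orbit points \<open>F i (x - z)\<close>, their affine hull and
  the common fixed point set are the translates of the objects belonging to \<open>T\<close> at \<open>x\<close>. A
  translation preserves distances, so the circumcenter and the projection are translated too.
  Thus \<open>circumcenter_map S\<^sub>F\<close> is the conjugate of \<open>circumcenter_map S\<close>, and so are their powers;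
  the norms in (i) and (ii) are equal term by term. The equivalence (b) follows from (a)
  because every \<open>y\<close> has the form \<open>x - z\<close>.

  The substance lies in the definite descriptions. A description is certain to
  commute with a translation only if it denotes, so unique existence has to be proved for both:

  \<^item> The set of common fixed points is closed, convex and nonempty. For such a set in a Hilbert
    space the parallelogram identity makes every minimizing sequence Cauchy
    (lemma \<open>best_approximation_ex1\<close>).

  \<^item> A common fixed point of the isometries is equidistant from all points of the orbit
    \<open>{T x |T. T \<in> S}\<close>. By Pythagoras its orthogonal projection onto the affine hull of the orbit
    is still equidistant, and two equidistant points in the affine hull differ by a vector that
    is both in and orthogonal to the direction space (lemma \<open>circumcenter_ex1\<close>).
\<close>

section \<open>Best approximation in closed convex sets\<close>

text \<open>
  The parallelogram identity for the two vectors \<open>x - p\<close> and \<open>x - q\<close>, whose mean joins \<open>x\<close> to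
  the midpoint of \<open>p\<close> and \<open>q\<close>; convexity keeps that midpoint in \<open>C\<close>, hence at distance at
  least \<open>d\<close>.
\<close>

lemma convex_near_minimizers_close:
  fixes x :: "'a::real_inner"
  assumes "convex C" "p \<in> C" "q \<in> C" "0 \<le> d" and d: "\<And>y. y \<in> C \<Longrightarrow> d \<le> dist x y"
  shows "(dist p q)\<^sup>2 \<le> 2 * (dist x p)\<^sup>2 + 2 * (dist x q)\<^sup>2 - 4 * d\<^sup>2"
proof -
  have "midpoint p q \<in> C"
    using convexD[OF assms(1-3), of "1/2" "1/2"] by (simp add: midpoint_def algebra_simps)
  then have "d\<^sup>2 \<le> (dist x (midpoint p q))\<^sup>2"
    using d \<open>0 \<le> d\<close> by (simp add: power_mono)
  moreover have "(dist p q)\<^sup>2 + 4 * (dist x (midpoint p q))\<^sup>2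
      = 2 * (dist x p)\<^sup>2 + 2 * (dist x q)\<^sup>2"
    by (simp add: dist_norm midpoint_def power2_norm_eq_inner algebra_simps inner_commute)
  ultimately show ?thesis by linarith
qed

lemma best_approximation_exists:
  fixes C :: "'a::{real_inner, complete_space} set"
  assumes "convex C" "closed C" "C \<noteq> {}"
  shows "\<exists>p\<in>C. \<forall>y\<in>C. dist x p \<le> dist x y"
proof -
  define d where "d = infdist x C"
  have d0: "0 \<le> d" by (simp add: d_def infdist_nonneg)
  have d: "d \<le> dist x y" if "y \<in> C" for y
    using that by (simp add: d_def infdist_le)
  have "\<exists>y\<in>C. dist x y < d + inverse (real (Suc n))" for n
  proof -
    have "Inf (dist x ` C) < d + inverse (real (Suc n))"
      using assms(3) by (simp add: d_def infdist_notempty)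
    then show ?thesis using cInf_lessD[of "dist x ` C"] assms(3) by fastforce
  qed
  then obtain y where yC: "\<And>n. y n \<in> C" and y: "\<And>n. dist x (y n) < d + inverse (real (Suc n))"
    by metis
  have lim: "(\<lambda>n. dist x (y n)) \<longlonglongrightarrow> d"
  proof (rule tendsto_sandwich[OF _ _ tendsto_const LIMSEQ_inverse_real_of_nat_add])
    show "\<forall>\<^sub>F n in sequentially. d \<le> dist x (y n)" by (simp add: d yC)
    show "\<forall>\<^sub>F n in sequentially. dist x (y n) \<le> d + inverse (real (Suc n))"
      by (intro always_eventually allI less_imp_le y)
  qed
  have "Cauchy y"
  proof (rule metric_CauchyI)
    fix e :: real assume "0 < e"
    have "(\<lambda>n. (dist x (y n))\<^sup>2) \<longlonglongrightarrow> d\<^sup>2"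
      by (intro tendsto_intros lim)
    then have "\<forall>\<^sub>F n in sequentially. (dist x (y n))\<^sup>2 < d\<^sup>2 + e\<^sup>2 / 4"
      using \<open>0 < e\<close> by (intro order_tendstoD(2)[of _ "d\<^sup>2"]) auto
    then obtain M where M: "\<And>n. n \<ge> M \<Longrightarrow> (dist x (y n))\<^sup>2 < d\<^sup>2 + e\<^sup>2 / 4"
      by (auto simp: eventually_sequentially)
    have "dist (y m) (y n) < e" if "m \<ge> M" "n \<ge> M" for m n
    proof -
      have "(dist (y m) (y n))\<^sup>2 < e\<^sup>2"
        using convex_near_minimizers_close[OF assms(1) yC yC d0 d, of m n]
          M[OF that(1)] M[OF that(2)] by fastforce
      then show ?thesis using \<open>0 < e\<close> power_less_imp_less_base by fastforce
    qed
    then show "\<exists>M. \<forall>m\<ge>M. \<forall>n\<ge>M. dist (y m) (y n) < e" by blast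
  qed
  then obtain p where p: "y \<longlonglongrightarrow> p"
    using Cauchy_convergent convergent_def by blast
  have "p \<in> C"
    using closed_sequentially[OF assms(2) _ p] yC by blast
  moreover have "dist x p = d"
    using LIMSEQ_unique[OF tendsto_dist[OF tendsto_const p] lim] .
  ultimately show ?thesis using d by blast
qed

lemma best_approximation_ex1:
  fixes C :: "'a::{real_inner, complete_space} set"
  assumes "convex C" "closed C" "C \<noteq> {}"
  shows "\<exists>!p. p \<in> C \<and> (\<forall>y\<in>C. dist x p \<le> dist x y)"
proof (rule ex_ex1I)
  show "\<exists>p. p \<in> C \<and> (\<forall>y\<in>C. dist x p \<le> dist x y)"
    using best_approximation_exists[OF assms] by blast
next
  fix p q
  assume p: "p \<in> C \<and> (\<forall>y\<in>C. dist x p \<le> dist x y)"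
    and q: "q \<in> C \<and> (\<forall>y\<in>C. dist x q \<le> dist x y)"
  then have "dist x p = dist x q" by (simp add: order_antisym)
  then have "(dist p q)\<^sup>2 \<le> 0"
    using convex_near_minimizers_close[OF assms(1), of p q "dist x p" x] p q by auto
  then show "p = q" by simp
qed

section \<open>Circumcenters of finite sets\<close>

text \<open>
  A Gram-Schmidt step: the part \<open>e\<close> of a new vector \<open>b\<close> orthogonal to \<open>span B\<close> adds one direction
  to the span, so the projection of \<open>f\<close> onto \<open>span B\<close> only has to be corrected by a multiple of
  \<open>e\<close>.
\<close>

lemma orthogonal_projection_span_exists:
  fixes B :: "'a::real_inner set"
  assumes "finite B"
  shows "\<exists>p\<in>span B. \<forall>y\<in>span B. (f - p) \<bullet> y = 0"
  using assms
proof (induction B arbitrary: f)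
  case empty
  then show ?case by simp
next
  case (insert b B)
  obtain p where p: "p \<in> span B" "\<And>y. y \<in> span B \<Longrightarrow> (f - p) \<bullet> y = 0"
    using insert.IH by blast
  obtain c where c: "c \<in> span B" "\<And>y. y \<in> span B \<Longrightarrow> (b - c) \<bullet> y = 0"
    using insert.IH by blast
  define e where "e = b - c"
  \<comment> \<open>If \<open>e = 0\<close>, division by zero gives \<open>t = 0\<close>, and \<open>p\<close> itself is the projection.\<close>
  define t where "t = ((f - p) \<bullet> e) / (e \<bullet> e)"
  define q where "q = p + t *\<^sub>R e"
  have qe: "(f - q) \<bullet> e = 0"
    by (cases "e = 0") (simp_all add: q_def t_def inner_diff_left inner_add_left)
  have qB: "(f - q) \<bullet> y = 0" if "y \<in> span B" for y
    using p(2)[OF that] c(2)[OF that]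
    by (simp add: q_def e_def inner_diff_left inner_add_left)
  have "q \<in> span (insert b B)"
    using p(1) c(1) span_mono[of B "insert b B"] unfolding q_def e_def
    by (intro span_add span_scale span_diff) (auto intro: span_base)
  moreover have "(f - q) \<bullet> y = 0" if y: "y \<in> span (insert b B)" for y
  proof -
    obtain k where "y - k *\<^sub>R b \<in> span B"
      using y span_breakdown_eq by blast
    then have "(f - q) \<bullet> (y - k *\<^sub>R b) = 0" by (rule qB)
    moreover have "(f - q) \<bullet> b = 0"
      using qe qB[OF c(1)] by (simp add: e_def inner_diff_right)
    ultimately show ?thesis by (simp add: inner_diff_right)
  qed
  ultimately show ?case by blast
qed

lemma mem_translation_iff: "p \<in> (+) a ` A \<longleftrightarrow> p - a \<in> A" for a :: "'a::ab_group_add"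
  by (metis add_diff_cancel_left' diff_add_cancel image_iff)

text \<open>
  The center \<open>f\<close> of the sphere through \<open>A\<close> may lie outside the affine hull; the foot of the
  perpendicular from \<open>f\<close> is a circumcenter. If \<open>p\<close> and \<open>q\<close> are both equidistant from the points
  of \<open>A\<close>, expanding the squared distances shows that \<open>p - q\<close> is orthogonal to all differences of
  these points, hence to itself if \<open>p\<close> and \<open>q\<close> lie in the affine hull.
\<close>

lemma circumcenter_ex1:
  fixes A :: "'a::real_inner set"
  assumes "finite A" "A \<noteq> {}" and f: "\<And>y. y \<in> A \<Longrightarrow> dist f y = s"
  shows "\<exists>!p. p \<in> affine hull A \<and> (\<exists>r. \<forall>y\<in>A. dist p y = r)"
proof -
  obtain a where a: "a \<in> A" using assms(2) by blast
  define B where "B = (\<lambda>y. y - a) ` (A - {a})"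
  have "finite B" using assms(1) by (simp add: B_def)
  have "affine hull A = (+) a ` span B"
    using affine_hull_span2[OF a] by (simp add: B_def)
  then have aff: "p \<in> affine hull A \<longleftrightarrow> p - a \<in> span B" for p
    by (simp only: mem_translation_iff)
  have diff: "y - a \<in> span B" if "y \<in> A" for y
    using aff[of y] hull_inc[OF that, of affine] by simp
  show ?thesis
  proof (rule ex_ex1I)
    obtain v where v: "v \<in> span B" "\<And>y. y \<in> span B \<Longrightarrow> ((f - a) - v) \<bullet> y = 0"
      using orthogonal_projection_span_exists[OF \<open>finite B\<close>] by blast
    define p where "p = a + v"
    \<comment> \<open>Pythagoras for the right angle at the foot \<open>p\<close> of the perpendicular from \<open>f\<close>.\<close>
    have "(dist p y)\<^sup>2 = s\<^sup>2 - (dist f p)\<^sup>2" if "y \<in> A" for y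
    proof -
      have "(f - p) \<bullet> (p - y) = ((f - a) - v) \<bullet> (v - (y - a))"
        by (simp add: p_def algebra_simps)
      also have "\<dots> = 0" by (intro v(2) span_diff v(1) diff that)
      finally have "(norm ((f - p) + (p - y)))\<^sup>2 = (norm (f - p))\<^sup>2 + (norm (p - y))\<^sup>2"
        by (intro norm_add_Pythagorean) (simp add: orthogonal_def)
      then show ?thesis using f[OF that] by (simp add: dist_norm)
    qed
    then have "dist p y = sqrt (s\<^sup>2 - (dist f p)\<^sup>2)" if "y \<in> A" for y
      using that by (metis real_sqrt_unique zero_le_dist)
    moreover have "p \<in> affine hull A" by (simp add: aff p_def v(1))
    ultimately show "\<exists>p. p \<in> affine hull A \<and> (\<exists>r. \<forall>y\<in>A. dist p y = r)" by blast
  next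
    fix p q
    assume p: "p \<in> affine hull A \<and> (\<exists>r. \<forall>y\<in>A. dist p y = r)"
      and q: "q \<in> affine hull A \<and> (\<exists>r. \<forall>y\<in>A. dist q y = r)"
    have "orthogonal (p - q) w" if w: "w \<in> B" for w
    proof -
      obtain y where y: "y \<in> A" "w = y - a" using w by (auto simp: B_def)
      have "(dist p y)\<^sup>2 = (dist p a)\<^sup>2" "(dist q y)\<^sup>2 = (dist q a)\<^sup>2"
        using p q y(1) a by metis+
      then show ?thesis
        by (simp add: y(2) orthogonal_def dist_norm power2_norm_eq_inner inner_diff_left
            inner_diff_right inner_commute)
    qed
    moreover have "p - q \<in> span B"
      using span_diff[of "p - a" B "q - a"] p q by (simp add: aff)
    ultimately have "orthogonal (p - q) (p - q)"
      using orthogonal_to_span by blast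
    then show "p = q" by (simp add: orthogonal_def)
  qed
qed

section \<open>Fixed points of affine isometries\<close>

lemma convex_Fix: "convex (Fix T)" if "affine_map T"
  using that unfolding convex_def affine_map_def Fix_def by auto

lemma closed_Fix:
  fixes T :: "'a::metric_space \<Rightarrow> 'a"
  assumes "isometry T"
  shows "closed (Fix T)"
proof -
  have "continuous_on UNIV T"
    using assms by (auto simp: isometry_def continuous_on_iff)
  then show ?thesis
    unfolding Fix_def by (intro closed_Collect_eq continuous_intros)
qed

section \<open>Behaviour under translation\<close>

text \<open>
  Unique existence matters: an empty or ambiguous description denotes an unspecified value, which
  has no reason to move with the predicate.
\<close>

lemma the_translate:
  fixes z :: "'a::ab_group_add"
  assumes "\<exists>!p. P p"
  shows "(THE p. P (p + z)) = (THE p. P p) - z"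
proof (rule the_equality)
  show "P ((THE p. P p) - z + z)" using theI'[OF assms] by simp
  show "p = (THE p. P p) - z" if "P (p + z)" for p
    using the1_equality[OF assms that] by simp
qed

lemma projector_translate:
  fixes C D :: "'a::{real_inner, complete_space} set"
  assumes "convex C" "closed C" "C \<noteq> {}" and D: "\<And>p. p \<in> D \<longleftrightarrow> p + z \<in> C"
  shows "projector D (x - z) = projector C x - z"
proof -
  have "(\<forall>y\<in>D. dist (x - z) p \<le> dist (x - z) y) \<longleftrightarrow> (\<forall>y\<in>C. dist x (p + z) \<le> dist x y)" for p
  proof -
    have "D = (\<lambda>y. y - z) ` C" by (force simp: D image_iff)
    then show ?thesis by (simp add: dist_norm algebra_simps)
  qed
  then show ?thesis
    unfolding projector_def D
    using the_translate[OF best_approximation_ex1[OF assms(1-3), of x], of z] by simp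
qed

lemma circumcenter_map_translate:
  fixes S S' :: "('a::{real_inner, complete_space} \<Rightarrow> 'a) set"
  assumes "finite S" "S \<noteq> {}" and iso: "\<And>T. T \<in> S \<Longrightarrow> isometry T"
    and fixed: "\<And>T. T \<in> S \<Longrightarrow> T f = f"
    and S': "S' = (\<lambda>T x. T (x + z) - z) ` S"
  shows "circumcenter_map S' (x - z) = circumcenter_map S x - z"
proof -
  define A where "A = {T x |T. T \<in> S}"
  have A: "A = (\<lambda>T. T x) ` S" by (auto simp: A_def)
  have A': "{T (x - z) |T. T \<in> S'} = (+) (- z) ` A"
  proof -
    have "{T (x - z) |T. T \<in> S'} = (\<lambda>T. T (x - z)) ` S'" by auto
    then show ?thesis by (simp add: A S' image_image)
  qed
  have "dist f y = dist f x" if y: "y \<in> A" for y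
  proof -
    obtain T where T: "T \<in> S" "y = T x" using y by (auto simp: A)
    then have "dist (T f) (T x) = dist f x" using iso by (simp add: isometry_def)
    then show ?thesis by (simp add: T fixed)
  qed
  then have ex1: "\<exists>!p. p \<in> affine hull A \<and> (\<exists>r. \<forall>y\<in>A. dist p y = r)"
    using assms(1,2) by (intro circumcenter_ex1) (auto simp: A)
  have "p \<in> affine hull ((+) (- z) ` A) \<longleftrightarrow> p + z \<in> affine hull A" for p
    by (simp only: affine_hull_translation mem_translation_iff diff_minus_eq_add)
  moreover have "(\<forall>y\<in>(+) (- z) ` A. dist p y = r) \<longleftrightarrow> (\<forall>y\<in>A. dist (p + z) y = r)" for p r
    by (simp add: dist_norm algebra_simps)
  ultimately show ?thesis
    unfolding circumcenter_map_def A' using the_translate[OF ex1, of z] by (simp add: A_def)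
qed

lemma funpow_translate:
  fixes f g :: "'a::ab_group_add \<Rightarrow> 'a"
  assumes "\<And>x. g (x - z) = f x - z"
  shows "(g ^^ k) (x - z) = (f ^^ k) x - z"
  by (induction k) (simp_all add: assms)

section \<open>Linear convergence of the circumcenter method\<close>

theorem theorem4p16:
  fixes T F :: "nat \<Rightarrow> 'a::{real_inner, complete_space} \<Rightarrow> 'a"
    and S S\<^sub>F :: "('a \<Rightarrow> 'a) set"
    and m :: nat and z :: 'a and \<gamma> :: real
  assumes "m \<noteq> 0"
    and "\<And>i. i \<in> {1..m} \<Longrightarrow> affine_map (T i)"
    and "\<And>i. i \<in> {1..m} \<Longrightarrow> isometry (T i)"
    and "(\<Inter>i\<in>{1..m}. Fix (T i)) \<noteq> {}"
    and "S = T ` {1..m}"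
    and "\<And>i x. i \<in> {1..m} \<Longrightarrow> F i x = T i (x + z) - z"
    and "S\<^sub>F = F ` {1..m}"
    and "0 \<le> \<gamma>" and "\<gamma> < 1"
  shows
    "(\<forall>x.
        (\<forall>k. norm ((circumcenter_map S ^^ k) x - projector (\<Inter>i\<in>{1..m}. Fix (T i)) x)
              \<le> \<gamma> ^ k * norm (x - projector (\<Inter>i\<in>{1..m}. Fix (T i)) x))
        \<longleftrightarrow>
        (\<forall>k. norm ((circumcenter_map S\<^sub>F ^^ k) (x - z)
                     - projector (\<Inter>i\<in>{1..m}. Fix (F i)) (x - z))
              \<le> \<gamma> ^ k * norm ((x - z) - projector (\<Inter>i\<in>{1..m}. Fix (F i)) (x - z))))
     \<and>
     (\<forall>x.
        converges_linearly (\<lambda>k. (circumcenter_map S ^^ k) x)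
          (projector (\<Inter>i\<in>{1..m}. Fix (T i)) x) \<gamma>
        \<longleftrightarrow>
        converges_linearly (\<lambda>k. (circumcenter_map S\<^sub>F ^^ k) (x - z))
          (projector (\<Inter>i\<in>{1..m}. Fix (F i)) (x - z)) \<gamma>)
     \<and>
     ((\<forall>x. converges_linearly (\<lambda>k. (circumcenter_map S ^^ k) x)
             (projector (\<Inter>i\<in>{1..m}. Fix (T i)) x) \<gamma>)
        \<longleftrightarrow>
        (\<forall>y. converges_linearly (\<lambda>k. (circumcenter_map S\<^sub>F ^^ k) y)
             (projector (\<Inter>i\<in>{1..m}. Fix (F i)) y) \<gamma>))"
proof -
  let ?C = "\<Inter>i\<in>{1..m}. Fix (T i)" and ?D = "\<Inter>i\<in>{1..m}. Fix (F i)"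
  obtain f where f: "f \<in> ?C" using assms(4) by blast
  have proj: "projector ?D (x - z) = projector ?C x - z" for x
  proof (rule projector_translate)
    show "convex ?C" using assms(2) by (intro convex_INT convex_Fix)
    show "closed ?C" using assms(3) by (intro closed_INT ballI closed_Fix)
    show "?C \<noteq> {}" by (fact assms(4))
    show "p \<in> ?D \<longleftrightarrow> p + z \<in> ?C" for p
      using assms(6) by (simp add: Fix_def diff_eq_eq)
  qed
  have SF: "S\<^sub>F = (\<lambda>T x. T (x + z) - z) ` S"
    unfolding assms(5,7) image_image by (intro image_cong refl ext) (rule assms(6))
  have "circumcenter_map S\<^sub>F (x - z) = circumcenter_map S x - z" for x
  proof (rule circumcenter_map_translate[OF _ _ _ _ SF])
    show "finite S" "S \<noteq> {}" using assms(1) by (auto simp: assms(5))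
    show "isometry U" if "U \<in> S" for U using that assms(3) by (auto simp: assms(5))
    show "U f = f" if "U \<in> S" for U using that f by (auto simp: assms(5) Fix_def)
  qed
  then have pow: "(circumcenter_map S\<^sub>F ^^ k) (x - z) = (circumcenter_map S ^^ k) x - z" for k x
    by (rule funpow_translate)
  have conv: "converges_linearly (\<lambda>k. (circumcenter_map S ^^ k) x) (projector ?C x) \<gamma>
      \<longleftrightarrow> converges_linearly (\<lambda>k. (circumcenter_map S\<^sub>F ^^ k) (x - z)) (projector ?D (x - z)) \<gamma>"
    for x
    unfolding converges_linearly_def pow proj by simp
  show ?thesis
  proof (intro conjI allI conv)
    show "(\<forall>x. converges_linearly (\<lambda>k. (circumcenter_map S ^^ k) x) (projector ?C x) \<gamma>)
        \<longleftrightarrow> (\<forall>y. converges_linearly (\<lambda>k. (circumcenter_map S\<^sub>F ^^ k) y) (projector ?D y) \<gamma>)"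
      unfolding conv by (metis add_diff_cancel_right')
  qed (simp only: pow proj diff_diff_eq2 diff_add_cancel)
qed

end
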